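(* Let $n \geq 2$ and let $\xi$ be a conformal vector field on the complex hyperbolic space $\mathbb{C}H^n$ of constant holomorphic sectional curvature $-1$. Then $\xi$ is a Killing vector field.
   Context: A smooth vector field $\xi$ on a Riemannian manifold $(M,g)$ is called conformal if there exists $\rho\in C^\infty(M)$ (its potential function) with $\mathcal{L}_\xi g = 2\rho g$, where $\mathcal{L}_\xi g$ is the Lie derivative of $g$ along $\xi$. It is Killing if $\mathcal{L}_\xi g=0$, i.e. $\rho = 0$. Vector fields are defined on all of $M$. $\mathbb{C}H^n$ denotes the complex hyperbolic space of complex dimension $n$ (real dimension $2n$) with constant holomorphic sectional curvature $-1$. It is realized as a Damek-Ricci space (a solvable Lie group with left-invariant metric) as follows: the underlying manifold is $\mathbb{R}^{2n}$ with global coordinates $(x^1,y^1,\ldots,x^{n-1},y^{n-1},z,a)$, and the metric $g$ is the one for which the following vector fields form an orthonormal frame: $$V_i=e^{a/2}\left(\frac{\partial}{\partial x^i}-\frac{y^i}{2}\frac{\partial}{\partial z}\right),\quad J_ZV_i=e^{a/2}\left(\frac{\partial}{\partial y^i}+\frac{x^i}{2}\frac{\partial}{\partial z}\right)\ (1\le i\le n-1),\quad Z=e^a\frac{\partial}{\partial z},\quad A=\frac{\partial}{\partial a}.$$ *)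

theory Defs
  imports "HOL-Analysis.Analysis"
begin

section \<open>Smooth maps on a Euclidean space\<close>

text \<open>For a finite-dimensional domain, \<open>C\<^sup>k\<close> regularity may be tested on the directional
  derivatives.\<close>

primrec Ck :: "nat \<Rightarrow> ('a::euclidean_space \<Rightarrow> 'b::real_normed_vector) \<Rightarrow> bool" where
  "Ck 0 f \<longleftrightarrow> continuous_on UNIV f"
| "Ck (Suc k) f \<longleftrightarrow>
     (\<forall>x. f differentiable (at x)) \<and> (\<forall>v. Ck k (\<lambda>x. frechet_derivative f (at x) v))"

definition smooth :: "('a::euclidean_space \<Rightarrow> 'b::real_normed_vector) \<Rightarrow> bool" where
  "smooth f \<longleftrightarrow> (\<forall>k. Ck k f)"


section \<open>Riemannian geometry in global coordinates\<close>

text \<open>The manifold is a Euclidean space \<open>'a\<close>, each of whose tangent spaces is identified with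
  \<open>'a\<close> by the coordinate frame. A vector field is thus a map \<open>'a \<Rightarrow> 'a\<close>, and a metric sends a
  point to a bilinear form on \<open>'a\<close>.\<close>

definition riemannian_metric :: "('a::euclidean_space \<Rightarrow> 'a \<Rightarrow> 'a \<Rightarrow> real) \<Rightarrow> bool" where
  "riemannian_metric g \<longleftrightarrow>
     (\<forall>p. bilinear (g p)) \<and>
     (\<forall>p u v. g p u v = g p v u) \<and>
     (\<forall>p u. u \<noteq> 0 \<longrightarrow> g p u u > 0) \<and>
     (\<forall>u v. smooth (\<lambda>p. g p u v))"

definition orthonormal_frame ::
  "('a::euclidean_space \<Rightarrow> 'a \<Rightarrow> 'a \<Rightarrow> real) \<Rightarrow> ('i \<Rightarrow> 'a \<Rightarrow> 'a) \<Rightarrow> bool" where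
  "orthonormal_frame g E \<longleftrightarrow>
     (\<forall>i. smooth (E i)) \<and>
     (\<forall>p i j. g p (E i p) (E j p) = (if i = j then 1 else 0)) \<and>
     (\<forall>p. span (range (\<lambda>i. E i p)) = UNIV)"

definition lie_bracket ::
  "('a::euclidean_space \<Rightarrow> 'a) \<Rightarrow> ('a \<Rightarrow> 'a) \<Rightarrow> 'a \<Rightarrow> 'a" where
  "lie_bracket X Y p =
     frechet_derivative Y (at p) (X p) - frechet_derivative X (at p) (Y p)"

text \<open>\<open>(L\<^sub>\<xi> g)(X,Y) = \<xi>(g(X,Y)) - g([\<xi>,X],Y) - g(X,[\<xi>,Y])\<close>\<close>

definition lie_derivative_metric ::
  "('a::euclidean_space \<Rightarrow> 'a \<Rightarrow> 'a \<Rightarrow> real) \<Rightarrow> ('a \<Rightarrow> 'a) \<Rightarrow>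
   ('a \<Rightarrow> 'a) \<Rightarrow> ('a \<Rightarrow> 'a) \<Rightarrow> 'a \<Rightarrow> real" where
  "lie_derivative_metric g \<xi> X Y p =
     frechet_derivative (\<lambda>q. g q (X q) (Y q)) (at p) (\<xi> p)
     - g p (lie_bracket \<xi> X p) (Y p) - g p (X p) (lie_bracket \<xi> Y p)"

definition conformal_with_potential ::
  "('a::euclidean_space \<Rightarrow> 'a \<Rightarrow> 'a \<Rightarrow> real) \<Rightarrow> ('a \<Rightarrow> 'a) \<Rightarrow> ('a \<Rightarrow> real) \<Rightarrow> bool" where
  "conformal_with_potential g \<xi> \<rho> \<longleftrightarrow>
     smooth \<xi> \<and> smooth \<rho> \<and>
     (\<forall>X Y p. smooth X \<longrightarrow> smooth Y \<longrightarrow>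
        lie_derivative_metric g \<xi> X Y p = 2 * \<rho> p * g p (X p) (Y p))"

definition conformal_vector_field ::
  "('a::euclidean_space \<Rightarrow> 'a \<Rightarrow> 'a \<Rightarrow> real) \<Rightarrow> ('a \<Rightarrow> 'a) \<Rightarrow> bool" where
  "conformal_vector_field g \<xi> \<longleftrightarrow> (\<exists>\<rho>. conformal_with_potential g \<xi> \<rho>)"

definition killing_vector_field ::
  "('a::euclidean_space \<Rightarrow> 'a \<Rightarrow> 'a \<Rightarrow> real) \<Rightarrow> ('a \<Rightarrow> 'a) \<Rightarrow> bool" where
  "killing_vector_field g \<xi> \<longleftrightarrow>
     smooth \<xi> \<and>
     (\<forall>X Y p. smooth X \<longrightarrow> smooth Y \<longrightarrow> lie_derivative_metric g \<xi> X Y p = 0)"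


section \<open>The complex hyperbolic space as a Damek--Ricci space\<close>

text \<open>A point is \<open>(x, y, z, a)\<close>, where the index type \<open>'m\<close> of \<open>x\<close> and \<open>y\<close> has \<open>n - 1\<close> elements;
  so the complex dimension is \<open>n = CARD('m) + 1\<close>.\<close>

type_synonym 'm ch_point = "(real ^ 'm) \<times> (real ^ 'm) \<times> real \<times> real"

datatype 'm ch_index = Ix_V 'm | Ix_JV 'm | Ix_Z | Ix_A

fun ch_frame :: "'m::finite ch_index \<Rightarrow> 'm ch_point \<Rightarrow> 'm ch_point" where
  "ch_frame (Ix_V i) (x, y, z, a) = exp (a / 2) *\<^sub>R (axis i 1, 0, - (y $ i / 2), 0)"
| "ch_frame (Ix_JV i) (x, y, z, a) = exp (a / 2) *\<^sub>R (0, axis i 1, x $ i / 2, 0)"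
| "ch_frame Ix_Z (x, y, z, a) = exp a *\<^sub>R (0, 0, 1, 0)"
| "ch_frame Ix_A (x, y, z, a) = (0, 0, 0, 1)"

text \<open>Existence and uniqueness of this metric are shown in \<open>ex1_ch_metric\<close> below.\<close>

definition ch_metric :: "'m::finite ch_point \<Rightarrow> 'm ch_point \<Rightarrow> 'm ch_point \<Rightarrow> real" where
  "ch_metric = (THE g. riemannian_metric g \<and> orthonormal_frame g ch_frame)"


section \<open>The metric is well defined\<close>

lemma Ck_SucD: "Ck (Suc k) f \<Longrightarrow> Ck k f"
proof (induction k arbitrary: f)
  case 0
  then show ?case
    by (auto simp: continuous_on_eq_continuous_at intro: differentiable_imp_continuous_within)
next
  case (Suc k)
  then show ?case by (metis Ck.simps(2))
qed

lemma Ck_const: "Ck k (\<lambda>x. c)"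
  by (induction k arbitrary: c) auto

lemma Ck_SucI:
  assumes "\<And>x. (f has_derivative f' x) (at x)" "\<And>v. Ck k (\<lambda>x. f' x v)"
  shows "Ck (Suc k) f"
proof -
  have "frechet_derivative f (at x) = f' x" for x
    using assms(1) frechet_derivative_at by metis
  then show ?thesis using assms by (auto simp: differentiable_def)
qed

lemma Ck_SucE:
  assumes "Ck (Suc k) f"
  obtains f' where "\<And>x. (f has_derivative f' x) (at x)" "\<And>v. Ck k (\<lambda>x. f' x v)"
  using assms that[of "\<lambda>x. frechet_derivative f (at x)"] by (auto simp: frechet_derivative_works)

lemma Ck_linear:
  assumes "bounded_linear f" shows "Ck k f"
proof (cases k)
  case 0
  then show ?thesis using assms by (simp add: linear_continuous_on)
next
  case (Suc k')
  show ?thesis unfolding Suc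
    by (rule Ck_SucI[where f' = "\<lambda>x. f"])
       (use assms in \<open>auto intro: bounded_linear_imp_has_derivative Ck_const\<close>)
qed

lemma Ck_add: "Ck k f \<Longrightarrow> Ck k g \<Longrightarrow> Ck k (\<lambda>x. f x + g x)"
proof (induction k arbitrary: f g)
  case 0
  then show ?case by (auto intro: continuous_on_add)
next
  case (Suc k)
  from Suc.prems(1) obtain f' where f:
    "\<And>x. (f has_derivative f' x) (at x)" "\<And>v. Ck k (\<lambda>x. f' x v)" by (rule Ck_SucE) blast
  from Suc.prems(2) obtain g' where g:
    "\<And>x. (g has_derivative g' x) (at x)" "\<And>v. Ck k (\<lambda>x. g' x v)" by (rule Ck_SucE) blast
  show ?case
    by (rule Ck_SucI[where f' = "\<lambda>x h. f' x h + g' x h"])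
       (auto intro: has_derivative_add f g Suc.IH)
qed

lemma Ck_scaleR:
  fixes f :: "'a::euclidean_space \<Rightarrow> real"
  shows "Ck k f \<Longrightarrow> Ck k g \<Longrightarrow> Ck k (\<lambda>x. f x *\<^sub>R g x)"
proof (induction k arbitrary: f g)
  case 0
  then show ?case by (auto intro: continuous_on_scaleR)
next
  case (Suc k)
  note lower = Suc.prems[THEN Ck_SucD]
  from Suc.prems(1) obtain f' where f:
    "\<And>x. (f has_derivative f' x) (at x)" "\<And>v. Ck k (\<lambda>x. f' x v)" by (rule Ck_SucE) blast
  from Suc.prems(2) obtain g' where g:
    "\<And>x. (g has_derivative g' x) (at x)" "\<And>v. Ck k (\<lambda>x. g' x v)" by (rule Ck_SucE) blast
  show ?case
    by (rule Ck_SucI[where f' = "\<lambda>x h. f x *\<^sub>R g' x h + f' x h *\<^sub>R g x"])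
       (auto intro!: has_derivative_scaleR f g Ck_add Suc.IH lower)
qed

lemma Ck_exp:
  assumes "bounded_linear f" shows "Ck k (\<lambda>x. exp (f x :: real))"
proof (induction k)
  case 0
  then show ?case using assms by (simp add: continuous_on_exp linear_continuous_on)
next
  case (Suc k)
  show ?case
  proof (rule Ck_SucI[where f' = "\<lambda>x h. exp (f x) *\<^sub>R f h"])
    show "((\<lambda>x. exp (f x)) has_derivative (\<lambda>h. exp (f x) *\<^sub>R f h)) (at x)" for x
      using bounded_linear_imp_has_derivative[OF assms, of "at x"]
      by (auto intro!: derivative_eq_intros)
    show "Ck k (\<lambda>x. exp (f x) *\<^sub>R f v)" for v
      by (intro Ck_scaleR Suc Ck_const)
  qed
qed

lemma smooth_const: "smooth (\<lambda>x. c)"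
  and smooth_linear: "bounded_linear f \<Longrightarrow> smooth f"
  and smooth_add: "smooth f \<Longrightarrow> smooth g \<Longrightarrow> smooth (\<lambda>x. f x + g x)"
  and smooth_scaleR: "smooth h \<Longrightarrow> smooth g \<Longrightarrow> smooth (\<lambda>x. h x *\<^sub>R g x)"
  for h :: "'a::euclidean_space \<Rightarrow> real" and f g :: "'a \<Rightarrow> 'b::real_normed_vector"
  by (auto simp: smooth_def intro: Ck_const Ck_linear Ck_add Ck_scaleR)

lemma smooth_exp: "bounded_linear f \<Longrightarrow> smooth (\<lambda>x. exp (f x :: real))"
  by (simp add: smooth_def Ck_exp)

text \<open>The explicit expression of the metric in the dual coframe
  \<open>e\<^sup>-\<^sup>a\<^sup>/\<^sup>2 dx\<^sub>i\<close>, \<open>e\<^sup>-\<^sup>a\<^sup>/\<^sup>2 dy\<^sub>i\<close>, \<open>e\<^sup>-\<^sup>a (dz + (\<Sum>i. y\<^sub>i dx\<^sub>i - x\<^sub>i dy\<^sub>i) / 2)\<close>, \<open>da\<close>.\<close>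

definition ch_eta :: "'m::finite ch_point \<Rightarrow> 'm ch_point \<Rightarrow> real" where
  "ch_eta p u = fst (snd (snd u)) + (fst (snd p) \<bullet> fst u - fst p \<bullet> fst (snd u)) / 2"

definition ch_formula :: "'m::finite ch_point \<Rightarrow> 'm ch_point \<Rightarrow> 'm ch_point \<Rightarrow> real" where
  "ch_formula p u v =
     exp (- snd (snd (snd p))) * (fst u \<bullet> fst v + fst (snd u) \<bullet> fst (snd v))
     + exp (- 2 * snd (snd (snd p))) * (ch_eta p u * ch_eta p v)
     + snd (snd (snd u)) * snd (snd (snd v))"

lemma smooth_ch_eta: "smooth (\<lambda>p. ch_eta p u)"
proof -
  have "bounded_linear (\<lambda>p :: 'a ch_point. (fst (snd p) \<bullet> fst u - fst p \<bullet> fst (snd u)) / 2)"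
    by (intro linear_conv_bounded_linear[THEN iffD1] linearI)
       (auto simp: inner_add_left algebra_simps diff_divide_distrib add_divide_distrib)
  then show ?thesis unfolding ch_eta_def by (intro smooth_add smooth_const smooth_linear)
qed

lemma ch_formula_pos:
  assumes "u \<noteq> 0" shows "ch_formula p u u > 0"
proof -
  obtain x y z a where u: "u = (x, y, z, a)" by (cases u) auto
  have nonneg: "exp s * (x \<bullet> x + y \<bullet> y) \<ge> 0" "exp t * (w * w) \<ge> 0" "a * a \<ge> 0" for s t w :: real
    by auto
  show ?thesis
  proof (cases "x = 0 \<and> y = 0")
    case False
    then have "x \<bullet> x + y \<bullet> y > 0"
      by (metis inner_gt_zero_iff inner_ge_zero add_pos_nonneg add_nonneg_pos)
    then have "exp (- snd (snd (snd p))) * (x \<bullet> x + y \<bullet> y) > 0" by simp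
    then show ?thesis
      using nonneg(2)[of "- 2 * snd (snd (snd p))" "ch_eta p u"] nonneg(3)
      unfolding ch_formula_def u fst_conv snd_conv by linarith
  next
    case True
    then have eta: "ch_eta p u = z" by (simp add: ch_eta_def u)
    have "z \<noteq> 0 \<or> a \<noteq> 0" using assms True by (auto simp: u zero_prod_def)
    then have "exp (- 2 * snd (snd (snd p))) * (z * z) + a * a > 0"
      by (metis add_nonneg_pos add_pos_nonneg nonneg(2,3) exp_gt_zero mult_pos_pos
          not_real_square_gt_zero)
    then show ?thesis unfolding ch_formula_def eta by (simp add: u True)
  qed
qed

lemma riemannian_ch_formula: "riemannian_metric (ch_formula :: 'm::finite ch_point \<Rightarrow> _)"
  unfolding riemannian_metric_def
proof (intro conjI allI impI)
  show "bilinear (ch_formula p)" for p :: "'m ch_point"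
    unfolding bilinear_def ch_formula_def ch_eta_def
    by (intro conjI allI linearI)
       (auto simp: inner_add_left inner_add_right algebra_simps diff_divide_distrib
         add_divide_distrib)
  show "ch_formula p u v = ch_formula p v u" for p u v :: "'m ch_point"
    by (simp add: ch_formula_def inner_commute mult.commute)
  show "ch_formula p u u > 0" if "u \<noteq> 0" for p u :: "'m ch_point"
    using that by (rule ch_formula_pos)
  show "smooth (\<lambda>p. ch_formula p u v)" for u v :: "'m ch_point"
  proof -
    have l: "bounded_linear (\<lambda>p :: 'm ch_point. - snd (snd (snd p)))"
      "bounded_linear (\<lambda>p :: 'm ch_point. - 2 *\<^sub>R snd (snd (snd p)))"
      unfolding linear_conv_bounded_linear[symmetric]
    by (auto intro!: linearI simp: algebra_simps)
    show ?thesis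
      unfolding ch_formula_def real_scaleR_def[symmetric]
      by (intro smooth_add smooth_scaleR smooth_const smooth_exp l smooth_ch_eta)
  qed
qed

lemma smooth_ch_frame: "smooth (ch_frame i :: 'm::finite ch_point \<Rightarrow> _)"
proof -
  have l: "bounded_linear (\<lambda>p :: 'm ch_point. snd (snd (snd p)) / 2)"
    "bounded_linear (\<lambda>p :: 'm ch_point. snd (snd (snd p)))"
    by (auto intro!: linear_conv_bounded_linear[THEN iffD1] linearI simp: add_divide_distrib)
  show ?thesis
  proof (cases i)
    case (Ix_V k)
    have eq: "ch_frame i = (\<lambda>p. exp (snd (snd (snd p)) / 2) *\<^sub>R
        ((axis k 1, 0, 0, 0) + (0, 0, - (fst (snd p) $ k / 2), 0)))"
      by (auto simp: Ix_V fun_eq_iff)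
    have "bounded_linear (\<lambda>p :: 'm ch_point.
        (0, 0, - (fst (snd p) $ k / 2), 0) :: 'm ch_point)"
      by (auto intro!: linear_conv_bounded_linear[THEN iffD1] linearI simp: add_divide_distrib)
    then show ?thesis unfolding eq
      by (intro smooth_add smooth_scaleR smooth_const smooth_exp l smooth_linear)
  next
    case (Ix_JV k)
    have eq: "ch_frame i = (\<lambda>p. exp (snd (snd (snd p)) / 2) *\<^sub>R
        ((0, axis k 1, 0, 0) + (0, 0, fst p $ k / 2, 0)))"
      by (auto simp: Ix_JV fun_eq_iff)
    have "bounded_linear (\<lambda>p :: 'm ch_point. (0, 0, fst p $ k / 2, 0) :: 'm ch_point)"
      by (auto intro!: linear_conv_bounded_linear[THEN iffD1] linearI simp: add_divide_distrib)
    then show ?thesis unfolding eq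
      by (intro smooth_add smooth_scaleR smooth_const smooth_exp l smooth_linear)
  next
    case Ix_Z
    have eq: "ch_frame i = (\<lambda>p. exp (snd (snd (snd p))) *\<^sub>R (0, 0, 1, 0))"
      by (auto simp: Ix_Z fun_eq_iff)
    show ?thesis unfolding eq by (intro smooth_scaleR smooth_const smooth_exp l)
  next
    case Ix_A
    have eq: "ch_frame i = (\<lambda>p. (0, 0, 0, 1))" by (auto simp: Ix_A fun_eq_iff)
    show ?thesis unfolding eq by (rule smooth_const)
  qed
qed

lemma span_ch_frame: "span (range (\<lambda>i. ch_frame i p)) = (UNIV :: 'm::finite ch_point set)"
proof -
  obtain x y z a where p: "p = (x, y, z, a)" by (cases p) auto
  let ?S = "span (range (\<lambda>i. ch_frame i p))"
  have fr: "ch_frame i p \<in> ?S" for i by (auto intro: span_base)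
  have Z: "(0, 0, s, 0) \<in> ?S" for s
    using span_scale[OF fr[of Ix_Z], of "s * exp (- a)"] by (simp add: p mult.assoc flip: exp_add)
  have A: "(0, 0, 0, s) \<in> ?S" for s
    using span_scale[OF fr[of Ix_A], of s] by (simp add: p)
  have ch_axis: "c *\<^sub>R axis k d = axis k (c * d)" for c d :: real and k :: 'm
    by (simp add: vec_eq_iff axis_def)
  have exp_cancel: "exp (- (a / 2)) * (exp (a / 2) * c) = c" for c
    by (simp flip: exp_add mult.assoc)
  have X: "(axis k s, 0, 0, 0) \<in> ?S" for k s
    using span_add[OF span_scale[OF fr[of "Ix_V k"], of "s * exp (- a / 2)"]
        Z[of "s * y $ k / 2"]]
    by (simp add: p ch_axis exp_cancel mult.assoc flip: exp_add)
  have Y: "(0, axis k s, 0, 0) \<in> ?S" for k s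
    using span_add[OF span_scale[OF fr[of "Ix_JV k"], of "s * exp (- a / 2)"]
        Z[of "- (s * x $ k / 2)"]]
    by (simp add: p ch_axis exp_cancel mult.assoc flip: exp_add)
  have "w \<in> ?S" for w
  proof -
    obtain ux uy uz ua where w: "w = (ux, uy, uz, ua)" by (cases w) auto
    have ax: "v = (\<Sum>k\<in>UNIV. axis k (v $ k))" for v :: "real ^ 'm"
      by (simp add: vec_eq_iff axis_def)
    have "(\<Sum>k\<in>UNIV. (axis k (ux $ k), 0, 0, 0) :: 'm ch_point) \<in> ?S"
      by (intro span_sum X)
    then have 1: "(ux, 0, 0, 0) \<in> ?S"
      by (subst ax) (simp add: sum_prod)
    have "(\<Sum>k\<in>UNIV. (0, axis k (uy $ k), 0, 0) :: 'm ch_point) \<in> ?S"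
      by (intro span_sum Y)
    then have 2: "(0, uy, 0, 0) \<in> ?S"
      by (subst ax) (simp add: sum_prod)
    show ?thesis
      using span_add[OF span_add[OF 1 2] span_add[OF Z[of uz] A[of ua]]] by (simp add: w)
  qed
  then show ?thesis by blast
qed

lemma orthonormal_ch_formula: "orthonormal_frame ch_formula (ch_frame :: 'm::finite ch_index \<Rightarrow> _)"
  unfolding orthonormal_frame_def
proof (intro conjI allI)
  fix p :: "'m ch_point" and i j :: "'m ch_index"
  obtain x y z a where p: "p = (x, y, z, a)" by (cases p) auto
  have e: "exp (- a) * (exp (a / 2) * exp (a / 2)) = 1" "exp (- 2 * a) * (exp a * exp a) = 1"
    by (simp_all flip: exp_add)
  have ax: "v \<bullet> axis k 1 = v $ k" "axis k 1 \<bullet> v = v $ k" for v :: "real ^ 'm" and k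
    by (simp_all add: inner_axis inner_axis')
  have ax0: "axis k 1 $ l = (0 :: real)" if "k \<noteq> l" for k l :: 'm
    using that by (simp add: axis_def)
  show "ch_formula p (ch_frame i p) (ch_frame j p) = (if i = j then 1 else 0)"
    using e by (cases i; cases j)
      (auto simp: p ch_formula_def ch_eta_def ax axis_nth ax0 algebra_simps)
qed (simp_all add: smooth_ch_frame span_ch_frame)

lemma orthonormal_frame_unique:
  assumes "riemannian_metric g" "orthonormal_frame g E"
    and "riemannian_metric h" "orthonormal_frame h E"
  shows "g = h"
proof (intro ext)
  fix p u v
  show "g p u v = h p u v"
  proof (rule bilinear_eq[where B = "range (\<lambda>i. E i p)" and C = "range (\<lambda>i. E i p)"
        and S = UNIV and T = UNIV])
    show "g p x y = h p x y" if "x \<in> range (\<lambda>i. E i p)" "y \<in> range (\<lambda>i. E i p)" for x y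
      using that assms(2,4) by (auto simp: orthonormal_frame_def)
  qed (use assms in \<open>auto simp: riemannian_metric_def orthonormal_frame_def\<close>)
qed

lemma ex1_ch_metric:
  "\<exists>!g :: 'm::finite ch_point \<Rightarrow> _. riemannian_metric g \<and> orthonormal_frame g ch_frame"
  using riemannian_ch_formula orthonormal_ch_formula orthonormal_frame_unique by blast

lemma ch_metric_eq: "ch_metric = ch_formula"
  unfolding ch_metric_def
  using ex1_ch_metric riemannian_ch_formula orthonormal_ch_formula by (blast intro: the1_equality)

end

theory Submission
  imports Defs
begin

text \<open>
  The geometric reason for the theorem is that a conformal vector field \<open>\<xi>\<close> preserves the Weyl
  tensor \<open>W\<close> as a tensor of type \<open>(1,3)\<close>, so the function \<open>|W|\<^sup>2\<close> satisfies
  \<open>\<xi>(|W|\<^sup>2) = -4 \<rho> |W|\<^sup>2\<close>. A complex hyperbolic space of complex dimension at least two is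
  homogeneous and not conformally flat, hence \<open>|W|\<^sup>2\<close> is a nonzero constant and \<open>\<rho> = 0\<close>. The
  statement is therefore local, and it follows from second-order consequences of the conformal
  equation. Instead of introducing connections and curvature, the proof extracts such consequences
  from the left-invariant frame directly.

  Fix one index \<open>i\<close> and write \<open>V\<close>, \<open>J\<close>, \<open>Z\<close>, \<open>A\<close> for the frame fields \<open>V\<^sub>i\<close>, \<open>J\<^sub>ZV\<^sub>i\<close>, \<open>Z\<close>, \<open>A\<close>.
  Their brackets \<open>[V,J] = Z\<close>, \<open>[A,V] = V/2\<close>, \<open>[A,J] = J/2\<close>, \<open>[A,Z] = Z\<close> span a four-dimensional
  subalgebra, the orbits of which are totally geodesic copies of \<open>\<complex>H\<^sup>2\<close>. Accordingly the ten components
  of \<open>L\<^sub>\<xi> g = 2 \<rho> g\<close> along these four fields involve only \<open>\<rho>\<close> and the four components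
  \<open>p = g(\<xi>,V)\<close>, \<open>q = g(\<xi>,J)\<close>, \<open>r = g(\<xi>,Z)\<close>, \<open>s = g(\<xi>,A)\<close>. With \<open>\<omega> = V q\<close>, the system gives

    \<^item> \<open>Z r = [V,J] r = V p + J q - 2 Z \<omega> = 2 \<rho> + s - 2 Z \<omega>\<close>, while \<open>Z r = \<rho> + s\<close>; so \<open>Z \<omega> = \<rho>/2\<close>;
    \<^item> \<open>Z s = [V,J] s = -2 A \<omega>\<close>, so \<open>Z Z s = -2 Z A \<omega> = -2 (A Z \<omega> - Z \<omega>) = - A \<rho> + \<rho>\<close>;
    \<^item> \<open>Z s = - A r - r\<close>, so \<open>Z Z s = - A Z r = - A \<rho> - A s = - A \<rho> - \<rho>\<close>.

  The two values of \<open>Z Z s\<close> differ by \<open>2 \<rho>\<close>, which must vanish. This is lemma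
  \<open>conformal_frame_system_potential_eq_0\<close>. The analytic input is that differentiation along smooth
  fields obeys \<open>X (Y f) - Y (X f) = [X,Y] f\<close> (\<open>deriv_along_commutator\<close>), which rests on the
  symmetry of second derivatives (\<open>mixed_derivatives_commute\<close>); the geometric input is the
  expression of \<open>L\<^sub>\<xi> g\<close> in an orthonormal frame (\<open>lie_derivative_metric_frame\<close>) together with
  the bracket table \<open>lie_bracket_ch_frame\<close>.
\<close>

section \<open>Smooth functions and the symmetry of second derivatives\<close>

lemma Ck_bounded_linear_comp:
  assumes "bounded_linear L"
  shows "Ck k f \<Longrightarrow> Ck k (\<lambda>x. L (f x))"
proof (induction k arbitrary: f)
  case 0
  then show ?case using bounded_linear.continuous_on[OF assms, of UNIV f] by simp
next
  case (Suc k)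
  from Suc.prems obtain f' where f:
    "\<And>x. (f has_derivative f' x) (at x)" "\<And>v. Ck k (\<lambda>x. f' x v)" by (rule Ck_SucE) blast
  show ?case
    by (rule Ck_SucI[where f' = "\<lambda>x h. L (f' x h)"])
       (auto intro: bounded_linear.has_derivative[OF assms] f Suc.IH)
qed

lemma smooth_bounded_linear_comp:
  "bounded_linear L \<Longrightarrow> smooth f \<Longrightarrow> smooth (\<lambda>x. L (f x))"
  by (simp add: smooth_def Ck_bounded_linear_comp)

lemma smooth_inner_const: "smooth X \<Longrightarrow> smooth (\<lambda>x. X x \<bullet> b)"
  by (rule smooth_bounded_linear_comp[OF bounded_linear_inner_left])

lemma smooth_sum: "(\<And>i. i \<in> I \<Longrightarrow> smooth (f i)) \<Longrightarrow> smooth (\<lambda>x. \<Sum>i\<in>I. f i x)"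
  by (induction I rule: infinite_finite_induct) (auto intro: smooth_const smooth_add)

lemma smooth_mult:
  fixes f g :: "'a::euclidean_space \<Rightarrow> real"
  shows "smooth f \<Longrightarrow> smooth g \<Longrightarrow> smooth (\<lambda>x. f x * g x)"
  using smooth_scaleR[of f g] by simp

lemma smooth_differentiable: "smooth f \<Longrightarrow> f differentiable (at x)"
  unfolding smooth_def by (metis Ck.simps(2))

lemma smooth_has_derivative:
  "smooth f \<Longrightarrow> (f has_derivative frechet_derivative f (at x)) (at x)"
  using smooth_differentiable frechet_derivative_works by blast

lemma smooth_frechet_derivative: "smooth f \<Longrightarrow> smooth (\<lambda>x. frechet_derivative f (at x) v)"
  unfolding smooth_def by (metis Ck.simps(2))

text \<open>The mean value theorem, applied to \<open>s \<mapsto> f (p + s u + h v) - f (p + s u)\<close> and then to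
  \<open>t \<mapsto> f' (p + s u + t v) u\<close>, turns the second difference of \<open>f\<close> into a second derivative at a
  nearby point.\<close>

lemma second_difference_mean_value:
  fixes f :: "'a::real_normed_vector \<Rightarrow> real"
  assumes f: "\<And>x. (f has_derivative f' x) (at x)"
    and fu: "\<And>x. ((\<lambda>x. f' x u) has_derivative g x) (at x)"
    and h: "h > 0"
  obtains s t where "0 < s" "s < h" "0 < t" "t < h"
    "f (p + h *\<^sub>R u + h *\<^sub>R v) - f (p + h *\<^sub>R u) - f (p + h *\<^sub>R v) + f p
       = h * h * g (p + s *\<^sub>R u + t *\<^sub>R v) v"
proof -
  have line: "((\<lambda>s. F (q + s *\<^sub>R w)) has_real_derivative F' (q + s *\<^sub>R w) w) (at s)"
    if "\<And>x. (F has_derivative F' x) (at x)" for F :: "'a \<Rightarrow> real" and F' q w s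
  proof -
    have "((\<lambda>s. q + s *\<^sub>R w) has_vector_derivative w) (at s)"
      by (auto intro!: derivative_eq_intros)
    from vector_derivative_diff_chain_within[OF this has_derivative_at_withinI, OF that]
    show ?thesis by (simp add: o_def has_real_derivative_iff_has_vector_derivative)
  qed
  let ?\<phi> = "\<lambda>s. f (p + h *\<^sub>R v + s *\<^sub>R u) - f (p + s *\<^sub>R u)"
  have "\<exists>s. 0 < s \<and> s < h \<and> ?\<phi> h - ?\<phi> 0
      = (h - 0) * (f' (p + h *\<^sub>R v + s *\<^sub>R u) u - f' (p + s *\<^sub>R u) u)"
    using h by (intro MVT2 DERIV_diff line f) auto
  then obtain s where s: "0 < s" "s < h"
    "?\<phi> h - ?\<phi> 0 = h * (f' (p + h *\<^sub>R v + s *\<^sub>R u) u - f' (p + s *\<^sub>R u) u)" by auto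
  let ?\<psi> = "\<lambda>t. f' (p + s *\<^sub>R u + t *\<^sub>R v) u"
  have "\<exists>t. 0 < t \<and> t < h \<and> ?\<psi> h - ?\<psi> 0 = (h - 0) * g (p + s *\<^sub>R u + t *\<^sub>R v) v"
    using h by (intro MVT2 line[where F = "\<lambda>x. f' x u"] fu) auto
  then obtain t where t: "0 < t" "t < h" "?\<psi> h - ?\<psi> 0 = h * g (p + s *\<^sub>R u + t *\<^sub>R v) v" by auto
  show ?thesis
  proof (rule that[OF s(1,2) t(1,2)])
    show "f (p + h *\<^sub>R u + h *\<^sub>R v) - f (p + h *\<^sub>R u) - f (p + h *\<^sub>R v) + f p
       = h * h * g (p + s *\<^sub>R u + t *\<^sub>R v) v"
      using s(3) t(3) by (simp add: algebra_simps)
  qed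
qed

text \<open>The second difference is symmetric in \<open>u\<close> and \<open>v\<close>, and by the previous lemma and the
  continuity of the second derivatives its quotient by \<open>h\<^sup>2\<close> tends to either mixed derivative
  as \<open>h\<close> runs through \<open>1 / (n + 1)\<close>.\<close>

lemma mixed_derivatives_commute:
  fixes f :: "'a::euclidean_space \<Rightarrow> real"
  assumes "Ck (Suc (Suc 0)) f"
  shows "frechet_derivative (\<lambda>q. frechet_derivative f (at q) u) (at p) v
       = frechet_derivative (\<lambda>q. frechet_derivative f (at q) v) (at p) u"
proof -
  define D where "D = (\<lambda>u q. frechet_derivative f (at q) u)"
  define DD where "DD = (\<lambda>u v q. frechet_derivative (D u) (at q) v)"
  have f: "(f has_derivative (\<lambda>u. D u x)) (at x)" for x
    using assms by (auto simp: D_def frechet_derivative_works)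
  have Df: "(D u has_derivative (\<lambda>v. DD u v x)) (at x)" for u x
    using assms by (auto simp: D_def DD_def frechet_derivative_works)
  have cont: "isCont (DD u v) p" for u v p
    using assms unfolding D_def DD_def by (simp add: continuous_on_eq_continuous_at)
  define \<delta> where "\<delta> u v h = f (p + h *\<^sub>R u + h *\<^sub>R v) - f (p + h *\<^sub>R u) - f (p + h *\<^sub>R v) + f p"
    for u v h
  have lim: "(\<lambda>n. \<delta> u v (inverse (real (Suc n))) * real (Suc n) ^ 2) \<longlonglongrightarrow> DD u v p" for u v
  proof -
    let ?h = "\<lambda>n. inverse (real (Suc n))"
    have "\<forall>n. \<exists>s t. 0 < s \<and> s < ?h n \<and> 0 < t \<and> t < ?h n \<and>
        \<delta> u v (?h n) = ?h n * ?h n * DD u v (p + s *\<^sub>R u + t *\<^sub>R v)"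
    proof
      fix n
      have "?h n > 0" by simp
      from second_difference_mean_value[OF f Df this, of p u v]
      show "\<exists>s t. 0 < s \<and> s < ?h n \<and> 0 < t \<and> t < ?h n \<and>
        \<delta> u v (?h n) = ?h n * ?h n * DD u v (p + s *\<^sub>R u + t *\<^sub>R v)"
        unfolding \<delta>_def by metis
    qed
    then obtain s t where st: "\<And>n. 0 < s n" "\<And>n. s n < ?h n" "\<And>n. 0 < t n" "\<And>n. t n < ?h n"
      "\<And>n. \<delta> u v (?h n) = ?h n * ?h n * DD u v (p + s n *\<^sub>R u + t n *\<^sub>R v)"
      by metis
    have "a \<longlonglongrightarrow> 0" if "\<And>n. 0 < a n" "\<And>n. a n < ?h n" for a
    proof (rule tendsto_sandwich[OF _ _ tendsto_const LIMSEQ_inverse_real_of_nat])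
      show "\<forall>\<^sub>F n in sequentially. 0 \<le> a n"
        by (rule always_eventually) (simp add: that(1) less_imp_le)
      show "\<forall>\<^sub>F n in sequentially. a n \<le> ?h n"
        by (rule always_eventually) (simp only: that(2) less_imp_le simp_thms)
    qed
    then have "s \<longlonglongrightarrow> 0" "t \<longlonglongrightarrow> 0" using st(1-4) by blast+
    then have "(\<lambda>n. p + s n *\<^sub>R u + t n *\<^sub>R v) \<longlonglongrightarrow> p + 0 *\<^sub>R u + 0 *\<^sub>R v"
      by (intro tendsto_intros)
    then have "(\<lambda>n. DD u v (p + s n *\<^sub>R u + t n *\<^sub>R v)) \<longlonglongrightarrow> DD u v p"
      by (intro isCont_tendsto_compose[OF cont]) simp
    moreover have "\<delta> u v (?h n) * real (Suc n) ^ 2 = DD u v (p + s n *\<^sub>R u + t n *\<^sub>R v)" for n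
    proof -
      have "inverse c * inverse c * d * c ^ 2 = d" if "c \<noteq> 0" for c d :: real
        using that by (simp add: power2_eq_square field_simps)
      then show ?thesis by (simp only: st(5))
    qed
    ultimately show ?thesis by (simp only:)
  qed
  have "\<delta> u v = \<delta> v u" by (auto simp: \<delta>_def fun_eq_iff add_ac)
  then have "DD u v p = DD v u p" using lim[of u v] lim[of v u] LIMSEQ_unique by metis
  then show ?thesis by (simp add: DD_def D_def)
qed

section \<open>Vector fields as derivations\<close>

definition deriv_along :: "('a::euclidean_space \<Rightarrow> 'a) \<Rightarrow> ('a \<Rightarrow> real) \<Rightarrow> 'a \<Rightarrow> real" where
  "deriv_along X f p = frechet_derivative f (at p) (X p)"

lemma linear_frechet: "smooth f \<Longrightarrow> linear (frechet_derivative f (at x))"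
  using smooth_has_derivative has_derivative_linear by blast

text \<open>The expansion in the standard basis reduces questions about the derivative of
  \<open>p \<mapsto> f' p (X p)\<close>, where the point enters twice, to finite sums of products.\<close>

lemma deriv_along_basis:
  assumes "smooth f"
  shows "deriv_along X f = (\<lambda>p. \<Sum>b\<in>Basis. (X p \<bullet> b) * frechet_derivative f (at p) b)"
proof
  fix p
  interpret linear "frechet_derivative f (at p)" using assms by (rule linear_frechet)
  have "deriv_along X f p = frechet_derivative f (at p) (\<Sum>b\<in>Basis. (X p \<bullet> b) *\<^sub>R b)"
    by (simp add: deriv_along_def euclidean_representation)
  then show "deriv_along X f p = (\<Sum>b\<in>Basis. (X p \<bullet> b) * frechet_derivative f (at p) b)"
    by (simp add: sum scaleR)
qed

lemma smooth_deriv_along: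
  assumes "smooth X" "smooth f"
  shows "smooth (deriv_along X f)"
proof -
  have "smooth (\<lambda>p. \<Sum>b\<in>Basis. (X p \<bullet> b) * frechet_derivative f (at p) b)"
    by (intro smooth_sum smooth_mult smooth_inner_const smooth_frechet_derivative assms)
  then show ?thesis by (simp only: deriv_along_basis[OF assms(2), of X])
qed

text \<open>The product rule for \<open>p \<mapsto> f' p (X p)\<close>: the first summand is the Hessian of \<open>f\<close> in the
  directions \<open>w\<close> and \<open>X p\<close>. Its symmetry is used to move \<open>w\<close> to the inner
  place, so that the basis expansion of \<open>X p\<close> can be summed up again by linearity.\<close>

lemma frechet_derivative_deriv_along:
  assumes X: "smooth X" and f: "smooth f"
  shows "frechet_derivative (deriv_along X f) (at p) w
       = frechet_derivative (\<lambda>q. frechet_derivative f (at q) w) (at p) (X p)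
         + frechet_derivative f (at p) (frechet_derivative X (at p) w)"
proof -
  let ?D = "\<lambda>b q. frechet_derivative f (at q) b"
  have D: "smooth (?D b)" for b using f by (rule smooth_frechet_derivative)
  interpret f': linear "frechet_derivative f (at p)" using f by (rule linear_frechet)
  interpret fw': linear "frechet_derivative (?D w) (at p)" using D by (rule linear_frechet)
  have "((\<lambda>q. \<Sum>b\<in>Basis. (X q \<bullet> b) * ?D b q) has_derivative
      (\<lambda>w. \<Sum>b\<in>Basis. (X p \<bullet> b) * frechet_derivative (?D b) (at p) w
                     + (frechet_derivative X (at p) w \<bullet> b) * ?D b p)) (at p)"
    by (intro has_derivative_sum has_derivative_mult smooth_has_derivative D
        has_derivative_inner_left X)
  from frechet_derivative_at[OF this]
  have "frechet_derivative (deriv_along X f) (at p) w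
      = (\<Sum>b\<in>Basis. (X p \<bullet> b) * frechet_derivative (?D b) (at p) w)
        + (\<Sum>b\<in>Basis. (frechet_derivative X (at p) w \<bullet> b) * ?D b p)"
    unfolding deriv_along_basis[OF f, of X] sum.distrib[symmetric] by (rule fun_cong[OF sym])
  also have "(\<Sum>b\<in>Basis. (X p \<bullet> b) * frechet_derivative (?D b) (at p) w)
      = (\<Sum>b\<in>Basis. (X p \<bullet> b) * frechet_derivative (?D w) (at p) b)"
    using f by (intro sum.cong refl arg_cong2[where f = times] mixed_derivatives_commute)
      (simp_all add: smooth_def)
  also have "\<dots> = frechet_derivative (?D w) (at p) (\<Sum>b\<in>Basis. (X p \<bullet> b) *\<^sub>R b)"
    by (simp add: fw'.sum fw'.scaleR)
  also have "(\<Sum>b\<in>Basis. (frechet_derivative X (at p) w \<bullet> b) * ?D b p)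
      = frechet_derivative f (at p) (\<Sum>b\<in>Basis. (frechet_derivative X (at p) w \<bullet> b) *\<^sub>R b)"
    by (simp add: f'.sum f'.scaleR)
  finally show ?thesis by (simp add: euclidean_representation)
qed

text \<open>The Hessian terms of \<open>X (Y f)\<close> and \<open>Y (X f)\<close> cancel by symmetry; the derivatives of the
  fields themselves form the bracket.\<close>

lemma deriv_along_commutator:
  assumes "smooth X" "smooth Y" "smooth f"
  shows "deriv_along X (deriv_along Y f) p - deriv_along Y (deriv_along X f) p
       = deriv_along (lie_bracket X Y) f p"
proof -
  interpret f': linear "frechet_derivative f (at p)" using assms(3) by (rule linear_frechet)
  have "frechet_derivative (\<lambda>q. frechet_derivative f (at q) (X p)) (at p) (Y p)
      = frechet_derivative (\<lambda>q. frechet_derivative f (at q) (Y p)) (at p) (X p)"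
    using assms by (intro mixed_derivatives_commute) (simp add: smooth_def)
  then have "frechet_derivative (deriv_along Y f) (at p) (X p)
        - frechet_derivative (deriv_along X f) (at p) (Y p)
      = frechet_derivative f (at p) (lie_bracket X Y p)"
    using assms by (simp add: frechet_derivative_deriv_along lie_bracket_def f'.diff)
  then show ?thesis by (simp only: deriv_along_def)
qed

lemma deriv_along_add:
  "smooth f \<Longrightarrow> smooth g \<Longrightarrow> deriv_along X (\<lambda>q. f q + g q) p = deriv_along X f p + deriv_along X g p"
  unfolding deriv_along_def
  by (subst frechet_derivative_at[symmetric, OF has_derivative_add])
     (auto intro: smooth_has_derivative)

lemma deriv_along_cmult:
  "smooth f \<Longrightarrow> deriv_along X (\<lambda>q. c * f q) p = c * deriv_along X f p"
  unfolding deriv_along_def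
  by (subst frechet_derivative_at[symmetric, OF has_derivative_mult_right])
     (auto intro: smooth_has_derivative)

lemma deriv_along_combination:
  assumes "smooth f" "smooth g"
  shows "deriv_along X (\<lambda>q. c * f q + d * g q) p = c * deriv_along X f p + d * deriv_along X g p"
  using assms by (simp add: deriv_along_add deriv_along_cmult smooth_mult smooth_const)

section \<open>The Lie derivative of a metric in an orthonormal frame\<close>

lemma orthonormal_frame_expansion:
  fixes E :: "'i \<Rightarrow> 'a::euclidean_space \<Rightarrow> 'a" and u p :: 'a
  assumes g: "riemannian_metric g" and E: "orthonormal_frame g E" and fin: "finite (UNIV :: 'i set)"
  shows "u = (\<Sum>k\<in>UNIV. g p u (E k p) *\<^sub>R E k p)"
proof -
  define w where "w = u - (\<Sum>k\<in>UNIV. g p u (E k p) *\<^sub>R E k p)"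
  have bil: "bilinear (g p)" using g by (simp add: riemannian_metric_def)
  interpret l: linear "\<lambda>u. g p u v" for v using bil by (simp add: bilinear_def)
  have r: "linear (g p w)" using bil by (simp add: bilinear_def)
  have on: "g p (E k p) (E j p) = (if k = j then 1 else 0)" for k j
    using E by (simp add: orthonormal_frame_def)
  have orth: "g p w (E j p) = 0" for j
  proof -
    have "g p w (E j p) = g p u (E j p) - (\<Sum>k\<in>UNIV. g p u (E k p) * g p (E k p) (E j p))"
      by (simp only: w_def l.diff l.sum l.scale real_scaleR_def)
    also have "(\<Sum>k\<in>UNIV. g p u (E k p) * g p (E k p) (E j p))
        = (\<Sum>k\<in>UNIV. if k = j then g p u (E k p) else 0)"
      by (intro sum.cong) (auto simp: on)
    also have "\<dots> = g p u (E j p)" using fin by simp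
    finally show ?thesis by simp
  qed
  have "g p w v = 0" if "v \<in> span (range (\<lambda>i. E i p))" for v
    by (rule linear_eq_0_on_span[OF r _ that]) (auto simp: orth)
  then have "g p w w = 0" using E by (simp add: orthonormal_frame_def)
  moreover have "g p w w > 0" if "w \<noteq> 0" using g that by (simp add: riemannian_metric_def)
  ultimately have "w = 0" by fastforce
  then show ?thesis by (simp add: w_def)
qed

lemma smooth_metric_apply:
  assumes g: "riemannian_metric g" and X: "smooth X" and Y: "smooth Y"
  shows "smooth (\<lambda>p. g p (X p) (Y p))"
proof -
  have bil: "bilinear (g p)" for p using g by (simp add: riemannian_metric_def)
  interpret l: linear "\<lambda>u. g p u v" for p v using bil by (simp add: bilinear_def)
  interpret r: linear "g p u" for p u using bil by (simp add: bilinear_def)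
  have "g p (X p) (Y p) = (\<Sum>b\<in>Basis. \<Sum>c\<in>Basis. (X p \<bullet> b) * ((Y p \<bullet> c) * g p b c))" for p
  proof -
    have "g p (X p) (Y p) = g p (\<Sum>b\<in>Basis. (X p \<bullet> b) *\<^sub>R b) (\<Sum>c\<in>Basis. (Y p \<bullet> c) *\<^sub>R c)"
      by (simp add: euclidean_representation)
    then show ?thesis
      by (simp only: l.sum l.scale, simp only: r.sum r.scale real_scaleR_def sum_distrib_left)
  qed
  moreover have "smooth (\<lambda>p. \<Sum>b\<in>Basis. \<Sum>c\<in>Basis. (X p \<bullet> b) * ((Y p \<bullet> c) * g p b c))"
    using g by (intro smooth_sum smooth_mult smooth_inner_const X Y)
      (auto simp: riemannian_metric_def)
  ultimately show ?thesis by (simp only:)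
qed

text \<open>Since \<open>\<xi> = (\<Sum>k. f\<^sub>k E\<^sub>k)\<close> and \<open>[f E\<^sub>k, E\<^sub>i] = f [E\<^sub>k, E\<^sub>i] - (E\<^sub>i f) E\<^sub>k\<close>, the tensor \<open>L\<^sub>\<xi> g\<close> depends
  only on the first derivatives of the components of \<open>\<xi>\<close> and on the structure functions of the
  frame.\<close>

lemma lie_derivative_metric_frame:
  fixes E :: "'i \<Rightarrow> 'a::euclidean_space \<Rightarrow> 'a"
  assumes g: "riemannian_metric g" and E: "orthonormal_frame g E" and fin: "finite (UNIV :: 'i set)"
    and \<xi>: "smooth \<xi>"
  defines "f \<equiv> \<lambda>k q. g q (\<xi> q) (E k q)"
  shows "lie_derivative_metric g \<xi> (E i) (E j) p
       = deriv_along (E i) (f j) p + deriv_along (E j) (f i) p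
         - (\<Sum>k\<in>UNIV. f k p * (g p (lie_bracket (E k) (E i) p) (E j p)
                              + g p (lie_bracket (E k) (E j) p) (E i p)))"
proof -
  have bil: "bilinear (g p)" using g by (simp add: riemannian_metric_def)
  interpret l: linear "\<lambda>u. g p u v" for v using bil by (simp add: bilinear_def)
  have sym: "g p u v = g p v u" for u v using g by (simp add: riemannian_metric_def)
  have on: "g q (E k q) (E j q) = (if k = j then 1 else 0)" for q k j
    using E by (simp add: orthonormal_frame_def)
  have sE: "smooth (E k)" for k using E by (simp add: orthonormal_frame_def)
  have sf: "smooth (f k)" for k unfolding f_def by (intro smooth_metric_apply g \<xi> sE)
  have \<xi>_eq: "\<xi> = (\<lambda>q. \<Sum>k\<in>UNIV. f k q *\<^sub>R E k q)"
    unfolding f_def using orthonormal_frame_expansion[OF g E fin] by blast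
  have der: "(\<xi> has_derivative
      (\<lambda>w. \<Sum>k\<in>UNIV. f k p *\<^sub>R frechet_derivative (E k) (at p) w
                     + frechet_derivative (f k) (at p) w *\<^sub>R E k p)) (at p)"
    by (subst \<xi>_eq)
       (intro has_derivative_sum has_derivative_scaleR smooth_has_derivative sE sf)
  have D\<xi>: "frechet_derivative \<xi> (at p) w = (\<Sum>k\<in>UNIV. f k p *\<^sub>R frechet_derivative (E k) (at p) w
                     + frechet_derivative (f k) (at p) w *\<^sub>R E k p)" for w
    by (simp only: frechet_derivative_at[OF der, symmetric])
  have br: "lie_bracket \<xi> (E i) p = (\<Sum>k\<in>UNIV. f k p *\<^sub>R lie_bracket (E k) (E i) p)
      - (\<Sum>k\<in>UNIV. deriv_along (E i) (f k) p *\<^sub>R E k p)" for i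
  proof -
    interpret E': linear "frechet_derivative (E i) (at p)" using sE by (rule linear_frechet)
    have "frechet_derivative (E i) (at p) (\<xi> p)
        = (\<Sum>k\<in>UNIV. f k p *\<^sub>R frechet_derivative (E i) (at p) (E k p))"
      by (subst \<xi>_eq) (simp add: E'.sum E'.scaleR)
    then show ?thesis
      by (simp add: lie_bracket_def D\<xi> deriv_along_def sum.distrib sum_subtractf scaleR_diff_right)
  qed
  have gbr: "g p (lie_bracket \<xi> (E i) p) (E j p)
      = (\<Sum>k\<in>UNIV. f k p * g p (lie_bracket (E k) (E i) p) (E j p)) - deriv_along (E i) (f j) p" for i j
  proof -
    have "(\<Sum>k\<in>UNIV. deriv_along (E i) (f k) p * g p (E k p) (E j p))
        = (\<Sum>k\<in>UNIV. if k = j then deriv_along (E i) (f k) p else 0)"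
      by (intro sum.cong) (auto simp: on)
    also have "\<dots> = deriv_along (E i) (f j) p" using fin by simp
    finally show ?thesis by (simp only: br l.diff l.sum l.scale real_scaleR_def)
  qed
  have "frechet_derivative (\<lambda>q. g q (E i q) (E j q)) (at p) (\<xi> p) = 0"
    by (simp add: on)
  then show ?thesis
    unfolding lie_derivative_metric_def sym[of "E i p" "lie_bracket \<xi> (E j) p"] gbr
    by (simp add: distrib_left sum.distrib)
qed

section \<open>The integrability condition of the conformal equations\<close>

text \<open>The ten equations are the components of \<open>L\<^sub>\<xi> g = 2 \<rho> g\<close> in the frame \<open>V, J, Z, A\<close>, each solved
  for one derivative. The system is overdetermined: comparing two evaluations of \<open>Z r\<close> expresses
  \<open>\<rho>\<close> by \<open>\<omega> = V q\<close>, and comparing two evaluations of \<open>Z (Z s)\<close> then forces \<open>\<rho> = 0\<close>.\<close>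

lemma conformal_frame_system_potential_eq_0:
  fixes V J Z A :: "'a::euclidean_space \<Rightarrow> 'a" and p q r s \<rho> :: "'a \<Rightarrow> real"
  assumes sm: "smooth V" "smooth J" "smooth Z" "smooth A"
      "smooth p" "smooth q" "smooth r" "smooth s" "smooth \<rho>"
    and VJ: "\<And>x. lie_bracket V J x = Z x"
    and VZ: "\<And>x. lie_bracket V Z x = 0" and JZ: "\<And>x. lie_bracket J Z x = 0"
    and AV: "\<And>x. lie_bracket A V x = (1/2) *\<^sub>R V x"
    and AJ: "\<And>x. lie_bracket A J x = (1/2) *\<^sub>R J x"
    and AZ: "\<And>x. lie_bracket A Z x = Z x"
    and eVV: "\<And>x. deriv_along V p x = \<rho> x + s x / 2"
    and eJJ: "\<And>x. deriv_along J q x = \<rho> x + s x / 2"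
    and eZZ: "\<And>x. deriv_along Z r x = \<rho> x + s x"
    and eAA: "\<And>x. deriv_along A s x = \<rho> x"
    and eVJ: "\<And>x. deriv_along J p x = - deriv_along V q x"
    and eVZ: "\<And>x. deriv_along V r x = - deriv_along Z p x - q x"
    and eJZ: "\<And>x. deriv_along J r x = p x - deriv_along Z q x"
    and eVA: "\<And>x. deriv_along V s x = - deriv_along A p x - p x / 2"
    and eJA: "\<And>x. deriv_along J s x = - deriv_along A q x - q x / 2"
    and eZA: "\<And>x. deriv_along Z s x = - deriv_along A r x - r x"
  shows "\<rho> x = 0"
proof -
  let ?D = deriv_along
  have scale: "frechet_derivative f (at x) (c *\<^sub>R X x) = c * ?D X f x" "frechet_derivative f (at x) 0 = 0"
    if "smooth f" for f :: "'a \<Rightarrow> real" and c X x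
    using linear_frechet[OF that] by (simp_all add: deriv_along_def linear_cmul linear_0)
  have cVJ: "?D V (?D J f) x - ?D J (?D V f) x = ?D Z f x"
    and cVZ: "?D V (?D Z f) x = ?D Z (?D V f) x"
    and cJZ: "?D J (?D Z f) x = ?D Z (?D J f) x"
    and cAV: "?D A (?D V f) x = ?D V (?D A f) x + ?D V f x / 2"
    and cAJ: "?D A (?D J f) x = ?D J (?D A f) x + ?D J f x / 2"
    and cAZ: "?D A (?D Z f) x = ?D Z (?D A f) x + ?D Z f x"
    if f: "smooth f" for f x
    using deriv_along_commutator[OF sm(1,2) f, of x] deriv_along_commutator[OF sm(1,3) f, of x]
      deriv_along_commutator[OF sm(2,3) f, of x] deriv_along_commutator[OF sm(4,1) f, of x]
      deriv_along_commutator[OF sm(4,2) f, of x] deriv_along_commutator[OF sm(4,3) f, of x]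
      scale(2)[OF f] scale(1)[OF f, of x "1/2"]
    by (simp_all add: deriv_along_def[of "lie_bracket _ _"] VJ VZ JZ AV AJ AZ
        deriv_along_def[of Z f, symmetric])
  (* The right-hand sides below are written as linear combinations with explicit coefficients
     so that deriv_along_combination matches them. *)
  define \<omega> where "\<omega> = ?D V q"
  have s\<omega>: "smooth \<omega>" unfolding \<omega>_def by (intro smooth_deriv_along sm)
  have Jp: "?D J p = (\<lambda>x. (-1) * \<omega> x)"
    by (simp add: \<omega>_def fun_eq_iff eVJ)
  have neg: "?D X (\<lambda>x. - \<omega> x) x = - ?D X \<omega> x" for X x
    using deriv_along_cmult[OF s\<omega>, of X "-1" x] by simp
  have Vr: "?D V r = (\<lambda>x. (-1) * ?D Z p x + (-1) * q x)"
    by (simp add: fun_eq_iff eVZ)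
  have Jr: "?D J r = (\<lambda>x. 1 * p x + (-1) * ?D Z q x)"
    by (simp add: fun_eq_iff eJZ)
  have Zr: "?D Z r = (\<lambda>x. 1 * \<rho> x + 1 * s x)"
    by (simp add: fun_eq_iff eZZ)
  have Vs: "?D V s = (\<lambda>x. (-1) * ?D A p x + (-1/2) * p x)"
    by (simp add: fun_eq_iff eVA)
  have Js: "?D J s = (\<lambda>x. (-1) * ?D A q x + (-1/2) * q x)"
    by (simp add: fun_eq_iff eJA)
  have Zs: "?D Z s = (\<lambda>x. (-1) * ?D A r x + (-1) * r x)"
    by (simp add: fun_eq_iff eZA)

  (* Z r = [V,J] r against the equation for Z r *)
  have Z\<omega>: "?D Z \<omega> = (\<lambda>x. (1/2) * \<rho> x)"
  proof
    fix x
    have "?D V (?D J r) x = ?D V p x - ?D Z \<omega> x"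
      unfolding Jr by (subst deriv_along_combination)
        (simp_all add: sm smooth_deriv_along cVZ \<omega>_def)
    moreover have "?D J (?D V r) x = ?D Z \<omega> x - ?D J q x"
      unfolding Vr by (subst deriv_along_combination)
        (simp_all add: sm smooth_deriv_along cJZ Jp neg)
    ultimately have "?D Z r x = ?D V p x + ?D J q x - 2 * ?D Z \<omega> x"
      using cVJ[OF sm(7), of x] by simp
    then show "?D Z \<omega> x = (1/2) * \<rho> x"
      using eVV[of x] eJJ[of x] eZZ[of x] by simp
  qed
  (* Z s = [V,J] s; the terms V q / 2 and J p / 2 cancel against those from [A,V] and [A,J] *)
  have Zs': "?D Z s = (\<lambda>x. (-2) * ?D A \<omega> x)"
  proof
    fix x
    have "?D V (?D J s) x = - ?D A \<omega> x"
      using cAV[OF sm(6), of x] unfolding Js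
      by (subst deriv_along_combination) (simp_all add: sm smooth_deriv_along \<omega>_def)
    moreover have "?D J (?D V s) x = ?D A \<omega> x"
      using cAJ[OF sm(5), of x] neg[of A x] unfolding Vs
      by (subst deriv_along_combination) (simp_all add: sm smooth_deriv_along neg Jp)
    ultimately show "?D Z s x = (-2) * ?D A \<omega> x"
      using cVJ[OF sm(8), of x] by simp
  qed
  have "?D Z (?D Z s) x = - ?D A \<rho> x + \<rho> x"
  proof -
    have "?D Z (?D Z s) x = (-2) * ?D Z (?D A \<omega>) x"
      unfolding Zs' by (intro deriv_along_cmult smooth_deriv_along sm s\<omega>)
    then show ?thesis
      using cAZ[OF s\<omega>, of x] deriv_along_cmult[OF sm(9), of A "1/2" x] by (simp add: Z\<omega>)
  qed
  moreover have "?D Z (?D Z s) x = - ?D A \<rho> x - \<rho> x"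
  proof -
    have "?D Z (?D Z s) x = - ?D Z (?D A r) x - ?D Z r x"
      unfolding Zs by (subst deriv_along_combination) (simp_all add: sm smooth_deriv_along)
    also have "\<dots> = - ?D A (?D Z r) x"
      using cAZ[OF sm(7), of x] by simp
    also have "\<dots> = - ?D A \<rho> x - \<rho> x"
      unfolding Zr by (subst deriv_along_combination) (simp_all add: sm eAA)
    finally show ?thesis .
  qed
  ultimately show ?thesis by simp
qed

section \<open>The complex hyperbolic frame\<close>

lemma frechet_ch_frame:
  "frechet_derivative (ch_frame (Ix_V i)) (at (x, y, z, a)) (wx, wy, wz, wa)
     = exp (a / 2) *\<^sub>R (axis i (wa / 2), 0, - (wa * y $ i / 2 + wy $ i) / 2, 0)"
  "frechet_derivative (ch_frame (Ix_JV i)) (at (x, y, z, a)) (wx, wy, wz, wa)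
     = exp (a / 2) *\<^sub>R (0, axis i (wa / 2), (wa * x $ i / 2 + wx $ i) / 2, 0)"
  "frechet_derivative (ch_frame Ix_Z) (at (x, y, z, a)) (wx, wy, wz, wa)
     = exp a *\<^sub>R (0, 0, wa, 0)"
  "frechet_derivative (ch_frame Ix_A) (at (x, y, z, a)) (wx, wy, wz, wa) = 0"
  for wx :: "real ^ 'm::finite"
proof -
  let ?p = "(x, y, z, a)" and ?w = "(wx, wy, wz, wa)"
  note nth = bounded_linear.has_derivative[OF bounded_linear_vec_nth]
  have ax: "c *\<^sub>R axis k d = axis k (c * d)" for c d :: real and k :: 'm
    by (simp add: vec_eq_iff axis_def)
  have eq: "ch_frame (Ix_V i) = (\<lambda>p. exp (snd (snd (snd p)) / 2) *\<^sub>R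
        (axis i 1, 0, - (fst (snd p) $ i / 2), 0))"
    "ch_frame (Ix_JV i) = (\<lambda>p. exp (snd (snd (snd p)) / 2) *\<^sub>R
        (0, axis i 1, fst p $ i / 2, 0))"
    "ch_frame Ix_Z = (\<lambda>p. exp (snd (snd (snd p))) *\<^sub>R (0, 0, 1, 0))"
    "ch_frame Ix_A = (\<lambda>p. (0, 0, 0, 1))"
    by (auto simp: fun_eq_iff)
  have "((\<lambda>p :: 'm ch_point. exp (snd (snd (snd p)) / 2) *\<^sub>R
        (axis i 1 :: real ^ 'm, 0 :: real ^ 'm, - (fst (snd p) $ i / 2), 0 :: real)) has_derivative
      (\<lambda>w. exp (a / 2) *\<^sub>R (0, 0, - (fst (snd w) $ i / 2), 0)
           + (exp (a / 2) * (snd (snd (snd w)) / 2)) *\<^sub>R (axis i 1, 0, - (y $ i / 2), 0))) (at ?p)"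
    by (auto intro!: derivative_eq_intros nth simp: fun_eq_iff field_simps)
  then show "frechet_derivative (ch_frame (Ix_V i)) (at ?p) ?w
     = exp (a / 2) *\<^sub>R (axis i (wa / 2), 0, - (wa * y $ i / 2 + wy $ i) / 2, 0)"
    unfolding eq
    by (subst frechet_derivative_at[OF _, symmetric], assumption) (simp add: ax field_simps)
  have "((\<lambda>p :: 'm ch_point. exp (snd (snd (snd p)) / 2) *\<^sub>R
        (0 :: real ^ 'm, axis i 1 :: real ^ 'm, fst p $ i / 2, 0 :: real)) has_derivative
      (\<lambda>w. exp (a / 2) *\<^sub>R (0, 0, fst w $ i / 2, 0)
           + (exp (a / 2) * (snd (snd (snd w)) / 2)) *\<^sub>R (0, axis i 1, x $ i / 2, 0))) (at ?p)"
    by (auto intro!: derivative_eq_intros nth simp: fun_eq_iff field_simps)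
  then show "frechet_derivative (ch_frame (Ix_JV i)) (at ?p) ?w
     = exp (a / 2) *\<^sub>R (0, axis i (wa / 2), (wa * x $ i / 2 + wx $ i) / 2, 0)"
    unfolding eq
    by (subst frechet_derivative_at[OF _, symmetric], assumption) (simp add: ax field_simps)
  have "((\<lambda>p :: 'm ch_point. exp (snd (snd (snd p))) *\<^sub>R
        (0 :: real ^ 'm, 0 :: real ^ 'm, 1 :: real, 0 :: real)) has_derivative
      (\<lambda>w. (exp a * snd (snd (snd w))) *\<^sub>R (0, 0, 1, 0))) (at ?p)"
    by (auto intro!: derivative_eq_intros)
  then show "frechet_derivative (ch_frame Ix_Z) (at ?p) ?w = exp a *\<^sub>R (0, 0, wa, 0)"
    unfolding eq
    by (subst frechet_derivative_at[OF _, symmetric], assumption) (simp add: ax field_simps)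
  show "frechet_derivative (ch_frame Ix_A) (at ?p) ?w = 0"
    unfolding eq by simp
qed

lemma lie_bracket_swap: "lie_bracket X Y p = - lie_bracket Y X p"
  by (simp add: lie_bracket_def)

text \<open>The structure equations of the solvable group: the fields \<open>V\<^sub>i\<close>, \<open>J\<^sub>ZV\<^sub>i\<close>, \<open>Z\<close> span the Heisenberg
  algebra with centre \<open>Z\<close>, on which \<open>A\<close> acts as a derivation with weights \<open>1/2\<close>, \<open>1/2\<close>, \<open>1\<close>.\<close>

lemma lie_bracket_ch_frame:
  "lie_bracket (ch_frame (Ix_V k)) (ch_frame (Ix_V i)) p = 0"
  "lie_bracket (ch_frame (Ix_V k)) (ch_frame (Ix_JV i)) p = of_bool (k = i) *\<^sub>R ch_frame Ix_Z p"
  "lie_bracket (ch_frame (Ix_JV k)) (ch_frame (Ix_V i)) p = - of_bool (k = i) *\<^sub>R ch_frame Ix_Z p"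
  "lie_bracket (ch_frame (Ix_JV k)) (ch_frame (Ix_JV i)) p = 0"
  "lie_bracket (ch_frame (Ix_V k)) (ch_frame Ix_Z) p = 0"
  "lie_bracket (ch_frame (Ix_JV k)) (ch_frame Ix_Z) p = 0"
  "lie_bracket (ch_frame Ix_Z) (ch_frame (Ix_V k)) p = 0"
  "lie_bracket (ch_frame Ix_Z) (ch_frame (Ix_JV k)) p = 0"
  "lie_bracket (ch_frame Ix_Z) (ch_frame Ix_Z) p = 0"
  "lie_bracket (ch_frame Ix_A) (ch_frame (Ix_V k)) p = (1/2) *\<^sub>R ch_frame (Ix_V k) p"
  "lie_bracket (ch_frame Ix_A) (ch_frame (Ix_JV k)) p = (1/2) *\<^sub>R ch_frame (Ix_JV k) p"
  "lie_bracket (ch_frame Ix_A) (ch_frame Ix_Z) p = ch_frame Ix_Z p"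
  "lie_bracket (ch_frame (Ix_V k)) (ch_frame Ix_A) p = (-1/2) *\<^sub>R ch_frame (Ix_V k) p"
  "lie_bracket (ch_frame (Ix_JV k)) (ch_frame Ix_A) p = (-1/2) *\<^sub>R ch_frame (Ix_JV k) p"
  "lie_bracket (ch_frame Ix_Z) (ch_frame Ix_A) p = - ch_frame Ix_Z p"
  "lie_bracket (ch_frame Ix_A) (ch_frame Ix_A) p = 0"
proof -
  obtain x y z a where p: "p = (x, y, z, a)" by (cases p) auto
  have e: "exp (a / 2) * (exp (a / 2) * c) = exp a * c" "exp (a / 2) * exp (a / 2) = exp a" for c
    by (simp_all flip: exp_add mult.assoc)
  have ax: "c *\<^sub>R axis k d = axis k (c * d)" "axis k d $ i = (if k = i then d else 0)"
    "axis k 0 = (0 :: real ^ 'a)" for c d :: real and k i :: 'a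
    by (auto simp: vec_eq_iff axis_def)
  note calc = p lie_bracket_def frechet_ch_frame ax e zero_prod_def field_simps
  show VV: "lie_bracket (ch_frame (Ix_V k)) (ch_frame (Ix_V i)) p = 0"
    and JJ: "lie_bracket (ch_frame (Ix_JV k)) (ch_frame (Ix_JV i)) p = 0"
    and VJ: "lie_bracket (ch_frame (Ix_V k)) (ch_frame (Ix_JV i)) p = of_bool (k = i) *\<^sub>R ch_frame Ix_Z p"
    for k i
    by (simp_all add: calc)
  show VZ: "lie_bracket (ch_frame (Ix_V k)) (ch_frame Ix_Z) p = 0"
    and JZ: "lie_bracket (ch_frame (Ix_JV k)) (ch_frame Ix_Z) p = 0"
    and ZZ: "lie_bracket (ch_frame Ix_Z) (ch_frame Ix_Z) p = 0"
    and AA: "lie_bracket (ch_frame Ix_A) (ch_frame Ix_A) p = 0"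
    by (simp_all add: calc)
  show AV: "lie_bracket (ch_frame Ix_A) (ch_frame (Ix_V k)) p = (1/2) *\<^sub>R ch_frame (Ix_V k) p"
    and AJ: "lie_bracket (ch_frame Ix_A) (ch_frame (Ix_JV k)) p = (1/2) *\<^sub>R ch_frame (Ix_JV k) p"
    and AZ: "lie_bracket (ch_frame Ix_A) (ch_frame Ix_Z) p = ch_frame Ix_Z p"
    by (simp_all add: calc)
  show "lie_bracket (ch_frame (Ix_JV k)) (ch_frame (Ix_V i)) p = - of_bool (k = i) *\<^sub>R ch_frame Ix_Z p"
    by (subst lie_bracket_swap, subst VJ) auto
  show "lie_bracket (ch_frame Ix_Z) (ch_frame (Ix_V k)) p = 0"
    by (subst lie_bracket_swap, subst VZ) simp
  show "lie_bracket (ch_frame Ix_Z) (ch_frame (Ix_JV k)) p = 0"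
    by (subst lie_bracket_swap, subst JZ) simp
  show "lie_bracket (ch_frame (Ix_V k)) (ch_frame Ix_A) p = (-1/2) *\<^sub>R ch_frame (Ix_V k) p"
    by (subst lie_bracket_swap, subst AV) simp
  show "lie_bracket (ch_frame (Ix_JV k)) (ch_frame Ix_A) p = (-1/2) *\<^sub>R ch_frame (Ix_JV k) p"
    by (subst lie_bracket_swap, subst AJ) simp
  show "lie_bracket (ch_frame Ix_Z) (ch_frame Ix_A) p = - ch_frame Ix_Z p"
    by (subst lie_bracket_swap, subst AZ) simp
qed

lemma UNIV_ch_index: "(UNIV :: 'm ch_index set) = range Ix_V \<union> range Ix_JV \<union> {Ix_Z, Ix_A}"
proof (rule set_eqI)
  fix k :: "'m ch_index"
  show "k \<in> UNIV \<longleftrightarrow> k \<in> range Ix_V \<union> range Ix_JV \<union> {Ix_Z, Ix_A}" by (cases k) auto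
qed

lemma finite_ch_index: "finite (UNIV :: 'm::finite ch_index set)"
  by (simp add: UNIV_ch_index)

lemma sum_ch_index:
  fixes F :: "'m::finite ch_index \<Rightarrow> real"
  shows "sum F UNIV = (\<Sum>k\<in>UNIV. F (Ix_V k)) + (\<Sum>k\<in>UNIV. F (Ix_JV k)) + F Ix_Z + F Ix_A"
proof -
  have inj: "inj Ix_V" "inj Ix_JV" by (auto intro: injI)
  have "sum F UNIV = sum F (range Ix_V \<union> range Ix_JV) + sum F {Ix_Z, Ix_A}"
    unfolding UNIV_ch_index by (rule sum.union_disjoint) auto
  also have "sum F (range Ix_V \<union> range Ix_JV) = sum F (range Ix_V) + sum F (range Ix_JV)"
    by (rule sum.union_disjoint) auto
  finally show ?thesis by (simp add: sum.reindex inj)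
qed

text \<open>If \<open>X\<close> is one of \<open>V\<^sub>i\<close>, \<open>J\<^sub>ZV\<^sub>i\<close>, \<open>Z\<close>, \<open>A\<close> and \<open>E\<^sub>k\<close> is a frame field outside these four, then
  \<open>[E\<^sub>k, X]\<close> is orthogonal to all four. So the components of \<open>\<xi>\<close> with an index other than \<open>i\<close> drop out
  of the sums over the frame, and the conformal equations for a single index close up.\<close>

lemma ch_conformal_potential_eq_0:
  fixes \<xi> :: "'m::finite ch_point \<Rightarrow> 'm ch_point"
  assumes "conformal_with_potential ch_metric \<xi> \<rho>"
  shows "\<rho> x = 0"
proof -
  define g :: "'m ch_point \<Rightarrow> _" where "g = ch_formula"
  define E :: "'m ch_index \<Rightarrow> _" where "E = ch_frame"
  define f where "f = (\<lambda>k q. g q (\<xi> q) (E k q))"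
  have g: "riemannian_metric g" unfolding g_def by (rule riemannian_ch_formula)
  have E: "orthonormal_frame g E" unfolding g_def E_def by (rule orthonormal_ch_formula)
  have \<xi>: "smooth \<xi>" "smooth \<rho>"
    and conf: "\<And>X Y q. smooth X \<Longrightarrow> smooth Y \<Longrightarrow>
        lie_derivative_metric g \<xi> X Y q = 2 * \<rho> q * g q (X q) (Y q)"
    using assms unfolding conformal_with_potential_def ch_metric_eq g_def by blast+
  have sE: "smooth (E k)" for k using E by (simp add: orthonormal_frame_def)
  have sf: "smooth (f k)" for k unfolding f_def by (intro smooth_metric_apply g \<xi> sE)
  have on: "g q (E k q) (E j q) = (if k = j then 1 else 0)" for q k j
    using E unfolding orthonormal_frame_def by blast
  have lin: "linear (\<lambda>u. g q u v)" for q v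
    using g unfolding riemannian_metric_def bilinear_def by blast
  interpret l: linear "\<lambda>u. g q u v" for q v by (rule lin)
  have frame_eq: "deriv_along (E i) (f j) q + deriv_along (E j) (f i) q
         - (\<Sum>k\<in>UNIV. f k q * (g q (lie_bracket (E k) (E i) q) (E j q)
                              + g q (lie_bracket (E k) (E j) q) (E i q)))
      = 2 * \<rho> q * (if i = j then 1 else 0)" for i j q
    using lie_derivative_metric_frame[OF g E finite_ch_index \<xi>(1), of i j q] conf[OF sE sE, of i j q]
    unfolding f_def on by simp
  note br = lie_bracket_ch_frame[where 'a = 'm, folded E_def]
  note calc = sum_ch_index br on l.scale l.zero l.neg
  obtain i :: 'm where True by simp
  have delta: "(\<Sum>k\<in>UNIV. F k * of_bool (k = i)) = F i" for F :: "'m \<Rightarrow> real"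
    by (simp add: of_bool_def if_distrib cong: if_cong)
  show ?thesis
  proof (rule conformal_frame_system_potential_eq_0[where V = "E (Ix_V i)" and J = "E (Ix_JV i)"
        and Z = "E Ix_Z" and A = "E Ix_A" and p = "f (Ix_V i)" and q = "f (Ix_JV i)"
        and r = "f Ix_Z" and s = "f Ix_A"])
    fix q
    show "deriv_along (E (Ix_V i)) (f (Ix_V i)) q = \<rho> q + f Ix_A q / 2"
      using frame_eq[of "Ix_V i" "Ix_V i" q] by (simp add: calc)
    show "deriv_along (E (Ix_JV i)) (f (Ix_JV i)) q = \<rho> q + f Ix_A q / 2"
      using frame_eq[of "Ix_JV i" "Ix_JV i" q] by (simp add: calc)
    show "deriv_along (E Ix_Z) (f Ix_Z) q = \<rho> q + f Ix_A q"
      using frame_eq[of Ix_Z Ix_Z q] by (simp add: calc)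
    show "deriv_along (E Ix_A) (f Ix_A) q = \<rho> q"
      using frame_eq[of Ix_A Ix_A q] by (simp add: calc)
    show "deriv_along (E (Ix_JV i)) (f (Ix_V i)) q = - deriv_along (E (Ix_V i)) (f (Ix_JV i)) q"
      using frame_eq[of "Ix_V i" "Ix_JV i" q] by (simp add: calc)
    show "deriv_along (E (Ix_V i)) (f Ix_Z) q = - deriv_along (E Ix_Z) (f (Ix_V i)) q - f (Ix_JV i) q"
      using frame_eq[of "Ix_V i" Ix_Z q] by (simp add: calc delta sum_negf)
    show "deriv_along (E (Ix_JV i)) (f Ix_Z) q = f (Ix_V i) q - deriv_along (E Ix_Z) (f (Ix_JV i)) q"
      using frame_eq[of "Ix_JV i" Ix_Z q] by (simp add: calc delta sum_negf)
    show "deriv_along (E (Ix_V i)) (f Ix_A) q = - deriv_along (E Ix_A) (f (Ix_V i)) q - f (Ix_V i) q / 2"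
      using frame_eq[of "Ix_V i" Ix_A q] by (simp add: calc if_distrib cong: if_cong)
    show "deriv_along (E (Ix_JV i)) (f Ix_A) q = - deriv_along (E Ix_A) (f (Ix_JV i)) q - f (Ix_JV i) q / 2"
      using frame_eq[of "Ix_JV i" Ix_A q] by (simp add: calc if_distrib cong: if_cong)
    show "deriv_along (E Ix_Z) (f Ix_A) q = - deriv_along (E Ix_A) (f Ix_Z) q - f Ix_Z q"
      using frame_eq[of Ix_Z Ix_A q] by (simp add: calc)
  qed (simp_all add: sE sf \<xi> br)
qed

theorem theorem1:
  fixes n :: nat
    and \<xi> :: "'m::finite ch_point \<Rightarrow> 'm ch_point"
  assumes "n \<ge> 2"
    and "n = CARD('m) + 1"
    and "conformal_vector_field ch_metric \<xi>"
  shows "killing_vector_field ch_metric \<xi>"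
proof -
  obtain \<rho> where \<rho>: "conformal_with_potential ch_metric \<xi> \<rho>"
    using assms(3) unfolding conformal_vector_field_def by blast
  then have "\<rho> p = 0" for p by (rule ch_conformal_potential_eq_0)
  then show ?thesis
    using \<rho> by (simp add: conformal_with_potential_def killing_vector_field_def)
qed

end
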